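(* Let $h: J\to[0,\infty)$ and $f:I\to(0,\infty)$. (i) If $h$ is superadditive and $f$ is $\mathrm{A_tH_h}$-concave, then for all $x,y,z\in I$ $$\frac{1}{f\left(\frac{x+z}{2}\right)}+\frac{1}{f\left(\frac{y+z}{2}\right)}+\frac{1}{f\left(\frac{x+y}{2}\right)}\le h(1/2)\left[\frac{1}{f(x)}+\frac{1}{f(y)}+\frac{1}{f(z)}\right]+\frac{h(3/2)}{f\left(\frac{x+y+z}{3}\right)}.$$ (ii) If $h$ is subadditive and $f$ is $\mathrm{A_tH_h}$-convex, then the reverse inequality ($\ge$) holds for all $x,y,z\in I$.
   Context: $I\subseteq(0,\infty)$ is an interval. $J$ is a real interval containing $(0,1)$ and the point $3/2$. The function $h:J\to[0,\infty)$ is such that $h(t)$ and $h(1-t)$ are never both zero. $h$ is superadditive (resp. subadditive) if $h(s+t)\ge h(s)+h(t)$ (resp. $\le$) whenever $s,t,s+t\in J$. A function $f:I\to(0,\infty)$ is $\mathrm{A_tH_h}$-convex if $$f(t\alpha+(1-t)\beta)\le \frac{f(\alpha)f(\beta)}{h(1-t)f(\alpha)+h(t)f(\beta)}$$ for all $\alpha,\beta\in I$ and all $t\in[0,1]$ with $t,1-t\in J$; it is $\mathrm{A_tH_h}$-concave if the reverse inequality ($\ge$) holds for all such $\alpha,\beta,t$. *)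

theory Defs
  imports "HOL-Analysis.Analysis"
begin

definition superadditive_on :: "real set \<Rightarrow> (real \<Rightarrow> real) \<Rightarrow> bool" where
  "superadditive_on J h \<longleftrightarrow>
    (\<forall>s t. s \<in> J \<longrightarrow> t \<in> J \<longrightarrow> s + t \<in> J \<longrightarrow> h (s + t) \<ge> h s + h t)"

definition subadditive_on :: "real set \<Rightarrow> (real \<Rightarrow> real) \<Rightarrow> bool" where
  "subadditive_on J h \<longleftrightarrow>
    (\<forall>s t. s \<in> J \<longrightarrow> t \<in> J \<longrightarrow> s + t \<in> J \<longrightarrow> h (s + t) \<le> h s + h t)"

text \<open>In the two definitions below the quotient is meant for \<open>f\<close> positive on \<open>I\<close> and \<open>h\<close>
  nonnegative on \<open>J\<close> with \<open>h t\<close> and \<open>h (1 - t)\<close> not both zero, so that the denominator is positive.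
  The endpoints \<open>t = 0\<close> and \<open>t = 1\<close> impose a condition only if both 0 and 1 lie in \<open>J\<close>.\<close>

definition AtHh_convex_on ::
    "real set \<Rightarrow> real set \<Rightarrow> (real \<Rightarrow> real) \<Rightarrow> (real \<Rightarrow> real) \<Rightarrow> bool" where
  "AtHh_convex_on I J h f \<longleftrightarrow>
    (\<forall>\<alpha>\<in>I. \<forall>\<beta>\<in>I. \<forall>t\<in>{0..1}. t \<in> J \<longrightarrow> 1 - t \<in> J \<longrightarrow>
      f (t * \<alpha> + (1 - t) * \<beta>) \<le> f \<alpha> * f \<beta> / (h (1 - t) * f \<alpha> + h t * f \<beta>))"

definition AtHh_concave_on ::
    "real set \<Rightarrow> real set \<Rightarrow> (real \<Rightarrow> real) \<Rightarrow> (real \<Rightarrow> real) \<Rightarrow> bool" where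
  "AtHh_concave_on I J h f \<longleftrightarrow>
    (\<forall>\<alpha>\<in>I. \<forall>\<beta>\<in>I. \<forall>t\<in>{0..1}. t \<in> J \<longrightarrow> 1 - t \<in> J \<longrightarrow>
      f (t * \<alpha> + (1 - t) * \<beta>) \<ge> f \<alpha> * f \<beta> / (h (1 - t) * f \<alpha> + h t * f \<beta>))"

end

theory Submission
  imports Defs
begin

text \<open>
  Passing to \<open>g = 1 / f\<close> turns \<open>AtHh\<close>-concavity of \<open>f\<close> into \<open>h\<close>-convexity of \<open>g\<close>, that is
  \<open>g (t * \<alpha> + (1 - t) * \<beta>) \<le> h t * g \<alpha> + h (1 - t) * g \<beta>\<close>, and \<open>AtHh\<close>-convexity of \<open>f\<close> into the
  reverse inequality (\<open>inverse_h_convex\<close>, \<open>inverse_h_concave\<close>). The claim is then Popoviciu's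
  inequality for \<open>g\<close>, with \<open>h\<close> in place of the identity.

  Let \<open>m\<close> be the mean of \<open>x, y, z\<close>. Two of the three points, say \<open>x\<close> and \<open>y\<close>, lie on the same side
  of \<open>m\<close> or at \<open>m\<close>. Then \<open>(x + z) / 2\<close> and \<open>(y + z) / 2\<close> both lie between \<open>m\<close> and \<open>z\<close>, and
  writing them as convex combinations of \<open>m\<close> and \<open>z\<close> the two weights of \<open>z\<close> add up to \<open>1 / 2\<close> and the two weights
  of \<open>m\<close> to \<open>3 / 2\<close>. Apply \<open>h\<close>-convexity to each of them, merge the values of \<open>h\<close> by
  superadditivity, and bound \<open>g ((x + y) / 2)\<close> by midpoint convexity
  (\<open>popoviciu_two_on_one_side\<close>).

  The weights may degenerate to 0 and 1, where \<open>h\<close>-convexity is not available when 0 is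
  outside \<open>J\<close>. There one uses that \<open>h\<close>-convexity at \<open>\<alpha> = \<beta>\<close> already forces \<open>h (1 / 2) \<ge> 1 / 2\<close>,
  and superadditivity then gives \<open>h (3 / 2) \<ge> 1 + h (1 / 2)\<close>, which pays
  for the weight 1 in the trivial bound \<open>g m \<le> 1 * g m\<close> at the degenerate point. In the
  \<open>AtHh\<close>-convex, subadditive case all these inequalities are reversed.
\<close>

section \<open>Popoviciu's inequality for \<open>h\<close>-convex functions\<close>

text \<open>The factor \<open>\<sigma>\<close> treats both directions at once: \<open>\<sigma> = 1\<close> is the \<open>h\<close>-convex, superadditive
  case and \<open>\<sigma> = -1\<close> the \<open>h\<close>-concave, subadditive one.\<close>

context
  fixes I :: "real set" and g h :: "real \<Rightarrow> real" and \<sigma> :: real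
  assumes I_convex: "convex I"
    and g_pos: "\<And>x. x \<in> I \<Longrightarrow> g x > 0"
    and g_hconvex: "\<And>\<alpha> \<beta> t. \<lbrakk>\<alpha> \<in> I; \<beta> \<in> I; 0 < t; t < 1\<rbrakk> \<Longrightarrow>
      \<sigma> * g (t * \<alpha> + (1 - t) * \<beta>) \<le> \<sigma> * (h t * g \<alpha> + h (1 - t) * g \<beta>)"
    and h_additive: "\<And>s t. \<lbrakk>0 < s; 0 < t; s + t \<le> 3 / 2\<rbrakk> \<Longrightarrow>
      \<sigma> * (h s + h t) \<le> \<sigma> * h (s + t)"
begin

lemma midpoint_h_convex:
  assumes "x \<in> I" "y \<in> I"
  shows "\<sigma> * g ((x + y) / 2) \<le> \<sigma> * (h (1 / 2) * (g x + g y))"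
  using g_hconvex[OF assms, of "1 / 2"] by (simp add: add_divide_distrib algebra_simps)

text \<open>Midpoint convexity at two equal points, divided by \<open>g x\<close>.\<close>

lemma h_half_bound:
  assumes "x \<in> I"
  shows "\<sigma> \<le> \<sigma> * (2 * h (1 / 2))"
proof -
  have "\<sigma> * g x \<le> (\<sigma> * (2 * h (1 / 2))) * g x"
    using midpoint_h_convex[OF assms assms] by (simp add: algebra_simps)
  then show ?thesis
    using g_pos[OF assms] by (rule mult_right_le_imp_le)
qed

lemma h_three_halves_bound:
  assumes "x \<in> I"
  shows "\<sigma> * (1 + h (1 / 2)) \<le> \<sigma> * h (3 / 2)"
proof -
  have "\<sigma> * (h (1 / 2) + h (1 / 2)) \<le> \<sigma> * h 1"
    using h_additive[of "1 / 2" "1 / 2"] by simp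
  moreover have "\<sigma> * (h 1 + h (1 / 2)) \<le> \<sigma> * h (3 / 2)"
    using h_additive[of 1 "1 / 2"] by simp
  ultimately show ?thesis
    using h_half_bound[OF assms] by (simp add: algebra_simps)
qed

lemma mean_of_three_mem:
  assumes "x \<in> I" "y \<in> I" "z \<in> I"
  shows "(x + y + z) / 3 \<in> I"
proof -
  have "(x + y) / 2 \<in> I"
    using convexD[OF I_convex assms(1,2), of "1 / 2" "1 / 2"] by (simp add: add_divide_distrib)
  then have "(2 / 3) *\<^sub>R ((x + y) / 2) + (1 / 3) *\<^sub>R z \<in> I"
    using convexD[OF I_convex _ assms(3), of "(x + y) / 2" "2 / 3" "1 / 3"]
    by (simp del: real_scaleR_def)
  moreover have "(2 / 3) *\<^sub>R ((x + y) / 2) + (1 / 3) *\<^sub>R z = (x + y + z) / 3"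
    by (simp add: field_simps)
  ultimately show ?thesis
    by metis
qed

text \<open>The two points that are pulled from \<open>m\<close> towards \<open>z\<close> by weights \<open>a\<close> and \<open>b\<close> with total
  weight \<open>1 / 2\<close>. If one weight vanishes the other is \<open>1 / 2\<close>, and the bound on \<open>h (3 / 2)\<close>
  replaces the use of \<open>h\<close>-convexity at the point \<open>m\<close> itself.\<close>

lemma two_weights_bound:
  assumes "m \<in> I" "z \<in> I" "0 \<le> a" "0 \<le> b" "a + b = 1 / 2"
  shows "\<sigma> * (g ((1 - a) * m + a * z) + g ((1 - b) * m + b * z))
    \<le> \<sigma> * (h (3 / 2) * g m + h (1 / 2) * g z)"
proof -
  have degenerate: "\<sigma> * (g m + g ((m + z) / 2)) \<le> \<sigma> * (h (3 / 2) * g m + h (1 / 2) * g z)"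
  proof -
    have "\<sigma> * (1 + h (1 / 2)) * g m \<le> \<sigma> * h (3 / 2) * g m"
      using h_three_halves_bound[OF assms(1)] g_pos[OF assms(1)] by (intro mult_right_mono) auto
    then show ?thesis
      using midpoint_h_convex[OF assms(1,2)] by (simp add: algebra_simps)
  qed
  consider "a = 0" "b = 1 / 2" | "b = 0" "a = 1 / 2" | "0 < a" "0 < b"
    using assms(3-5) by linarith
  then show ?thesis
  proof cases
    case 1
    show ?thesis
      using degenerate unfolding 1 by (simp add: add_divide_distrib)
  next
    case 2
    show ?thesis
      using degenerate unfolding 2 by (simp add: add_divide_distrib add.commute)
  next
    case 3
    have a: "\<sigma> * g ((1 - a) * m + a * z) \<le> \<sigma> * (h (1 - a) * g m + h a * g z)"
      using g_hconvex[OF assms(1,2), of "1 - a"] 3 assms(5) by simp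
    have b: "\<sigma> * g ((1 - b) * m + b * z) \<le> \<sigma> * (h (1 - b) * g m + h b * g z)"
      using g_hconvex[OF assms(1,2), of "1 - b"] 3 assms(5) by simp
    have sum: "(1 - a) + (1 - b) = 3 / 2"
      using assms(5) by simp
    have "\<sigma> * (h (1 - a) + h (1 - b)) \<le> \<sigma> * h (3 / 2)"
      using h_additive[of "1 - a" "1 - b", unfolded sum] 3 assms(5) by simp
    then have m: "\<sigma> * (h (1 - a) + h (1 - b)) * g m \<le> \<sigma> * h (3 / 2) * g m"
      using g_pos[OF assms(1)] by (intro mult_right_mono) auto
    have "\<sigma> * (h a + h b) \<le> \<sigma> * h (1 / 2)"
      using h_additive[of a b] 3 assms(5) by simp
    then have z: "\<sigma> * (h a + h b) * g z \<le> \<sigma> * h (1 / 2) * g z"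
      using g_pos[OF assms(2)] by (intro mult_right_mono) auto
    show ?thesis
      using a b m z by (simp add: algebra_simps)
  qed
qed

text \<open>The hypothesis on the sign of the product says that \<open>x\<close> and \<open>y\<close> are on the same side of the
  mean, so that no ordering of the points has to be chosen.\<close>

lemma popoviciu_two_on_one_side:
  assumes "x \<in> I" "y \<in> I" "z \<in> I"
    and m_def: "m = (x + y + z) / 3"
    and same_side: "0 \<le> (m - x) * (m - y)"
  shows "\<sigma> * (g ((x + z) / 2) + g ((y + z) / 2) + g ((x + y) / 2))
    \<le> \<sigma> * (h (1 / 2) * (g x + g y + g z) + h (3 / 2) * g m)"
proof -
  have m: "m \<in> I"
    using mean_of_three_mem[OF assms(1-3)] by (simp add: m_def)
  have z: "z - m = (m - x) + (m - y)"
    by (simp add: m_def field_simps)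
  obtain a b where ab: "0 \<le> a" "0 \<le> b" "a + b = 1 / 2"
    and xz: "(x + z) / 2 = (1 - a) * m + a * z" and yz: "(y + z) / 2 = (1 - b) * m + b * z"
  proof (cases "z = m")
    case True
    \<comment> \<open>The deviations of \<open>x\<close> and \<open>y\<close> have the same sign and cancel, so all three points
      coincide and any weights with sum \<open>1 / 2\<close> will do.\<close>
    have "(m - x) * (m - y) = - (m - x)\<^sup>2"
      using z True by (simp add: power2_eq_square eq_neg_iff_add_eq_0 flip: distrib_left)
    then have "(m - x)\<^sup>2 \<le> 0"
      using same_side by simp
    then have "x = m" "y = m"
      using z True by auto
    then show ?thesis
      using that[of 0 "1 / 2"] True by simp
  next
    case False
    \<comment> \<open>\<open>(x + z) / 2 - m = (m - y) / 2\<close>, and \<open>a\<close> is the ratio of this to \<open>z - m\<close>; likewise \<open>b\<close>.\<close>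
    define a where "a = (m - y) / (2 * (z - m))"
    define b where "b = (m - x) / (2 * (z - m))"
    have "0 \<le> a" "0 \<le> b"
      using same_side unfolding a_def b_def z
      by (auto simp: zero_le_mult_iff zero_le_divide_iff)
    moreover have "a + b = 1 / 2"
    proof -
      have "a + b = (z - m) / (2 * (z - m))"
        unfolding a_def b_def add_divide_distrib[symmetric] using z by (simp add: add.commute)
      then show ?thesis
        using False by simp
    qed
    moreover have "(x + z) / 2 = m + (m - y) / 2" "(y + z) / 2 = m + (m - x) / 2"
      using z by (simp_all add: field_simps)
    moreover have "a * (z - m) = (m - y) / 2" "b * (z - m) = (m - x) / 2"
      using False by (simp_all add: a_def b_def field_simps)
    moreover have "m + c * (z - m) = (1 - c) * m + c * z" for c
      by (simp add: algebra_simps)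
    ultimately show ?thesis
      using that by metis
  qed
  show ?thesis
    using two_weights_bound[OF m assms(3) ab] midpoint_h_convex[OF assms(1,2)]
    by (simp add: xz yz algebra_simps)
qed

text \<open>Two of the three deviations from the mean have a nonnegative product, so one of the three
  labellings of the points is covered by the preceding lemma.\<close>

theorem popoviciu_h_convex:
  assumes "x \<in> I" "y \<in> I" "z \<in> I"
  shows "\<sigma> * (g ((x + z) / 2) + g ((y + z) / 2) + g ((x + y) / 2))
    \<le> \<sigma> * (h (1 / 2) * (g x + g y + g z) + h (3 / 2) * g ((x + y + z) / 3))"
proof -
  define m where "m = (x + y + z) / 3"
  have perms: "m = (x + z + y) / 3" "m = (y + z + x) / 3"
    by (simp_all add: m_def)
  consider "0 \<le> (m - x) * (m - y)" | "0 \<le> (m - x) * (m - z)" | "0 \<le> (m - y) * (m - z)"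
    by (simp add: zero_le_mult_iff) linarith
  then show ?thesis
  proof cases
    case 1
    then show ?thesis
      using popoviciu_two_on_one_side[OF assms m_def] by (simp add: m_def)
  next
    case 2
    then show ?thesis
      using popoviciu_two_on_one_side[OF assms(1,3,2) perms(1)] by (simp add: m_def ac_simps)
  next
    case 3
    then show ?thesis
      using popoviciu_two_on_one_side[OF assms(2,3,1) perms(2)] by (simp add: m_def ac_simps)
  qed
qed

end

section \<open>Reciprocals of \<open>AtHh\<close>-concave and \<open>AtHh\<close>-convex functions\<close>

lemma weighted_denominator_pos:
  fixes p q u v :: real
  assumes "0 < u" "0 < v" "0 \<le> p" "0 \<le> q" "\<not> (p = 0 \<and> q = 0)"
  shows "0 < q * u + p * v"
  using assms by (metis add_nonneg_pos add_pos_nonneg less_eq_real_def mult_nonneg_nonneg mult_pos_pos)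

text \<open>Since \<open>h t\<close> and \<open>h (1 - t)\<close> do not both vanish, the quotient in the definition is positive and
  is the reciprocal of the \<open>h\<close>-combination of \<open>1 / f \<alpha>\<close> and \<open>1 / f \<beta>\<close>; taking reciprocals
  therefore reverses the defining inequality.\<close>

lemma inverse_h_convex:
  assumes "AtHh_concave_on I J h f"
    and "\<alpha> \<in> I" "\<beta> \<in> I" "0 \<le> t" "t \<le> 1" "t \<in> J" "1 - t \<in> J"
    and "0 < f \<alpha>" "0 < f \<beta>" "0 \<le> h t" "0 \<le> h (1 - t)" "\<not> (h t = 0 \<and> h (1 - t) = 0)"
  shows "1 / f (t * \<alpha> + (1 - t) * \<beta>) \<le> h t * (1 / f \<alpha>) + h (1 - t) * (1 / f \<beta>)"
proof -
  have d: "0 < h (1 - t) * f \<alpha> + h t * f \<beta>"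
    using assms(8-12) by (rule weighted_denominator_pos)
  have "f \<alpha> * f \<beta> / (h (1 - t) * f \<alpha> + h t * f \<beta>) \<le> f (t * \<alpha> + (1 - t) * \<beta>)"
    using assms(1-7) unfolding AtHh_concave_on_def by simp
  then have "1 / f (t * \<alpha> + (1 - t) * \<beta>) \<le> 1 / (f \<alpha> * f \<beta> / (h (1 - t) * f \<alpha> + h t * f \<beta>))"
    using d assms(8,9) by (intro divide_left_mono) (auto intro!: mult_pos_pos divide_pos_pos elim: less_le_trans[rotated])
  also have "\<dots> = h t * (1 / f \<alpha>) + h (1 - t) * (1 / f \<beta>)"
    using assms(8,9) by (simp add: field_simps)
  finally show ?thesis .
qed

lemma inverse_h_concave:
  assumes "AtHh_convex_on I J h f"
    and "\<alpha> \<in> I" "\<beta> \<in> I" "0 \<le> t" "t \<le> 1" "t \<in> J" "1 - t \<in> J"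
    and "0 < f \<alpha>" "0 < f \<beta>" "0 \<le> h t" "0 \<le> h (1 - t)" "\<not> (h t = 0 \<and> h (1 - t) = 0)"
    and "0 < f (t * \<alpha> + (1 - t) * \<beta>)"
  shows "h t * (1 / f \<alpha>) + h (1 - t) * (1 / f \<beta>) \<le> 1 / f (t * \<alpha> + (1 - t) * \<beta>)"
proof -
  have d: "0 < h (1 - t) * f \<alpha> + h t * f \<beta>"
    using assms(8-12) by (rule weighted_denominator_pos)
  have "f (t * \<alpha> + (1 - t) * \<beta>) \<le> f \<alpha> * f \<beta> / (h (1 - t) * f \<alpha> + h t * f \<beta>)"
    using assms(1-7) unfolding AtHh_convex_on_def by simp
  then have "1 / (f \<alpha> * f \<beta> / (h (1 - t) * f \<alpha> + h t * f \<beta>)) \<le> 1 / f (t * \<alpha> + (1 - t) * \<beta>)"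
    using d assms(8,9,13) by (intro divide_left_mono) auto
  moreover have "1 / (f \<alpha> * f \<beta> / (h (1 - t) * f \<alpha> + h t * f \<beta>))
      = h t * (1 / f \<alpha>) + h (1 - t) * (1 / f \<beta>)"
    using assms(8,9) by (simp add: field_simps)
  ultimately show ?thesis
    by simp
qed

section \<open>The inequality for \<open>AtHh\<close>-concave and \<open>AtHh\<close>-convex functions\<close>

theorem theorem4:
  fixes I J :: "real set" and h f :: "real \<Rightarrow> real"
  assumes I_interval: "is_interval I"
    and I_pos: "I \<subseteq> {0<..}"
    and J_interval: "is_interval J"
    and J_unit: "{0<..<1} \<subseteq> J"
    and J_three_halves: "3 / 2 \<in> J"
    and h_nonneg: "\<And>t. t \<in> J \<Longrightarrow> h t \<ge> 0"
    and h_not_both_zero: "\<And>t. t \<in> J \<Longrightarrow> 1 - t \<in> J \<Longrightarrow> \<not> (h t = 0 \<and> h (1 - t) = 0)"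
    and f_pos: "\<And>x. x \<in> I \<Longrightarrow> f x > 0"
  shows
    "(superadditive_on J h \<and> AtHh_concave_on I J h f \<longrightarrow>
        (\<forall>x\<in>I. \<forall>y\<in>I. \<forall>z\<in>I.
          1 / f ((x + z) / 2) + 1 / f ((y + z) / 2) + 1 / f ((x + y) / 2)
            \<le> h (1 / 2) * (1 / f x + 1 / f y + 1 / f z) + h (3 / 2) / f ((x + y + z) / 3)))
     \<and> (subadditive_on J h \<and> AtHh_convex_on I J h f \<longrightarrow>
        (\<forall>x\<in>I. \<forall>y\<in>I. \<forall>z\<in>I.
          1 / f ((x + z) / 2) + 1 / f ((y + z) / 2) + 1 / f ((x + y) / 2)
            \<ge> h (1 / 2) * (1 / f x + 1 / f y + 1 / f z) + h (3 / 2) / f ((x + y + z) / 3)))"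
proof -
  have I_convex: "convex I"
    using I_interval by (simp add: is_interval_convex)
  have J_sub: "{0<..3 / 2} \<subseteq> J"
  proof
    fix t :: real
    assume t: "t \<in> {0<..3 / 2}"
    then have "t / 2 \<in> J"
      using J_unit by auto
    then show "t \<in> J"
      using mem_is_interval_1_I[OF J_interval _ J_three_halves, of "t / 2" t] t by simp
  qed
  have g_pos: "0 < 1 / f x" if "x \<in> I" for x
    using f_pos[OF that] by simp
  have concave_case: "1 / f ((x + z) / 2) + 1 / f ((y + z) / 2) + 1 / f ((x + y) / 2)
      \<le> h (1 / 2) * (1 / f x + 1 / f y + 1 / f z) + h (3 / 2) / f ((x + y + z) / 3)"
    if super: "superadditive_on J h" and conc: "AtHh_concave_on I J h f"
      and xyz: "x \<in> I" "y \<in> I" "z \<in> I" for x y z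
  proof -
    have add: "1 * (h s + h t) \<le> 1 * h (s + t)" if "0 < s" "0 < t" "s + t \<le> 3 / 2" for s t
    proof -
      have "s \<in> J" "t \<in> J" "s + t \<in> J"
        using J_sub that by auto
      then show ?thesis
        using super by (simp add: superadditive_on_def)
    qed
    have conv: "1 * (1 / f (t * \<alpha> + (1 - t) * \<beta>)) \<le> 1 * (h t * (1 / f \<alpha>) + h (1 - t) * (1 / f \<beta>))"
      if "\<alpha> \<in> I" "\<beta> \<in> I" "0 < t" "t < 1" for \<alpha> \<beta> t
    proof -
      have "t \<in> J" "1 - t \<in> J"
        using J_unit that by auto
      then show ?thesis
        using inverse_h_convex[OF conc that(1,2), of t] that f_pos h_nonneg h_not_both_zero by simp
    qed
    show ?thesis
      using popoviciu_h_convex[of I "\<lambda>x. 1 / f x" 1 h, OF I_convex g_pos conv add xyz] by simp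
  qed
  have convex_case: "1 / f ((x + z) / 2) + 1 / f ((y + z) / 2) + 1 / f ((x + y) / 2)
      \<ge> h (1 / 2) * (1 / f x + 1 / f y + 1 / f z) + h (3 / 2) / f ((x + y + z) / 3)"
    if sub: "subadditive_on J h" and conv: "AtHh_convex_on I J h f"
      and xyz: "x \<in> I" "y \<in> I" "z \<in> I" for x y z
  proof -
    have add: "- 1 * (h s + h t) \<le> - 1 * h (s + t)" if "0 < s" "0 < t" "s + t \<le> 3 / 2" for s t
    proof -
      have "s \<in> J" "t \<in> J" "s + t \<in> J"
        using J_sub that by auto
      then have "h (s + t) \<le> h s + h t"
        using sub by (simp add: subadditive_on_def)
      then show ?thesis
        by simp
    qed
    have conc: "- 1 * (1 / f (t * \<alpha> + (1 - t) * \<beta>))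
        \<le> - 1 * (h t * (1 / f \<alpha>) + h (1 - t) * (1 / f \<beta>))"
      if "\<alpha> \<in> I" "\<beta> \<in> I" "0 < t" "t < 1" for \<alpha> \<beta> t
    proof -
      have "t \<in> J" "1 - t \<in> J"
        using J_unit that by auto
      moreover have "t * \<alpha> + (1 - t) * \<beta> \<in> I"
        using convexD[OF I_convex that(1,2), of t "1 - t"] that by simp
      ultimately have "h t * (1 / f \<alpha>) + h (1 - t) * (1 / f \<beta>) \<le> 1 / f (t * \<alpha> + (1 - t) * \<beta>)"
        using inverse_h_concave[OF conv that(1,2), of t] that f_pos h_nonneg h_not_both_zero by simp
      then show ?thesis
        by simp
    qed
    show ?thesis
      using popoviciu_h_convex[of I "\<lambda>x. 1 / f x" "- 1" h, OF I_convex g_pos conc add xyz] by simp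
  qed
  show ?thesis
    using concave_case convex_case by blast
qed

end
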